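(* Let the smoothness-ABG assumption hold and suppose that $f$ satisfies the Polyak-Łojasiewicz condition: there is $\gamma>0$ such that $\|\nabla f(x)\|^2\ge\gamma(f(x)-f^* )$ for all $x\in\mathbb R^d$. Suppose in addition that $\alpha_k\le\bar\alpha$ for all $k$, with $2\bar\alpha\,d\lambda B/l\le1$. Let $(x_k)$ be generated by S-SZD from a deterministic $x_0\in\mathbb R^d$ with step-sizes $\alpha_k>0$ and discretizations $h_k>0$, and let $f_k:=f(x_k)$. Then, for every $k\in\mathbb N$, $$\mathbb E[f_{k+1}]-f^*\le\left[1-\alpha_k\left(\frac\gamma2-\frac{d\lambda(A+\gamma B)}{l}\bar\alpha\right)\right]\left(\mathbb E[f_k]-f^*\right)+C_k,$$ where $$C_k:=\frac{\lambda d}{l}\alpha_k^2G+\alpha_kh_k^2\left(\frac{\lambda d}{2\sqrt l}\right)^2\left(\frac12+\frac{\lambda d}{l}\alpha_k\right).$$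
   Context: Setting. $1\le l\le d$ are integers, $\|\cdot\|$ is the Euclidean norm. $Z$ is a random variable with values in a measurable space $\mathcal Z$, $F:\mathbb R^d\times\mathcal Z\to\mathbb R$, $f(x):=\mathbb E[F(x,Z)]$, $f^*:=\inf f$, and $\nabla$ denotes the gradient in the variable $x$. Smoothness-ABG assumption. (i) There is $\lambda>0$ such that for every $z\in\mathcal Z$ the function $x\mapsto F(x,z)$ is differentiable with $\lambda$-Lipschitz gradient. (ii) $f(x)<+\infty$ for every $x\in\mathbb R^d$, $f$ is differentiable and has at least one minimizer. (iii) There are constants $A,B,G>0$ such that for every $x\in\mathbb R^d$, $\mathbb E[\|\nabla F(x,Z)\|^2]\le A(f(x)-f^* )+B\|\nabla f(x)\|^2+G$. Algorithm S-SZD. $(Z_k)_{k\in\mathbb N}$ are independent copies of $Z$. $(P_k)_{k\in\mathbb N}$ are random $d\times l$ matrices, each satisfying $\mathbb E[P_kP_k^\intercal]=I$ and $P_k^\intercal P_k=\frac dl I$ almost surely; all the $P_k$ and $Z_k$ are mutually independent. With $p_k^{(i)}$ the $i$-th column of $P_k$, the iteration is $$x_{k+1}=x_k-\alpha_k\sum_{i=1}^l\frac{F(x_k+h_kp_k^{(i)},Z_k)-F(x_k,Z_k)}{h_k}\,p_k^{(i)},\qquad k=0,1,2,\dots$$ *)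

theory Defs
  imports "HOL-Probability.Probability"
begin

text \<open>\<open>grad g x\<close> is meaningful only where \<open>g\<close> is differentiable.\<close>

definition grad :: "('a::real_inner \<Rightarrow> real) \<Rightarrow> 'a \<Rightarrow> 'a" where
  "grad g x = (THE D. GDERIV g x :> D)"

definition objective :: "'w measure \<Rightarrow> ('a \<Rightarrow> 'z \<Rightarrow> real) \<Rightarrow> ('w \<Rightarrow> 'z) \<Rightarrow> 'a \<Rightarrow> real" where
  "objective M F Z x = (\<integral>\<omega>. F x (Z \<omega>) \<partial>M)"

text \<open>
  Finiteness of \<open>\<E>[F(x, Z)]\<close> is integrability; without it the Bochner integral in
  \<open>objective\<close> would be the dummy value \<open>0\<close>.  The second moment of the gradient is a
  nonnegative integral for the same reason: the bound then forces it to be finite.  The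
  argument of \<open>ennreal\<close> on the right is positive, since the infimum is attained and \<open>G > 0\<close>.
\<close>

definition smoothness_ABG ::
  "'w measure \<Rightarrow> 'z measure \<Rightarrow> ('a::euclidean_space \<Rightarrow> 'z \<Rightarrow> real) \<Rightarrow> ('w \<Rightarrow> 'z) \<Rightarrow>
   real \<Rightarrow> real \<Rightarrow> real \<Rightarrow> real \<Rightarrow> bool" where
  "smoothness_ABG M S F Z lam A B G \<longleftrightarrow>
     (let f = objective M F Z in
        lam > 0 \<and>
        (\<forall>z\<in>space S. (\<forall>x. (\<lambda>y. F y z) differentiable (at x)) \<and>
                     lam-lipschitz_on UNIV (grad (\<lambda>y. F y z))) \<and>
        (\<forall>x. integrable M (\<lambda>\<omega>. F x (Z \<omega>))) \<and>
        (\<forall>x. f differentiable (at x)) \<and>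
        (\<exists>x. \<forall>y. f x \<le> f y) \<and>
        A > 0 \<and> B > 0 \<and> G > 0 \<and>
        (\<forall>x. (\<integral>\<^sup>+\<omega>. ennreal ((norm (grad (\<lambda>y. F y (Z \<omega>)) x))\<^sup>2) \<partial>M)
              \<le> ennreal (A * (f x - (INF y. f y)) + B * (norm (grad f x))\<^sup>2 + G)))"

definition polyak_lojasiewicz :: "('a::euclidean_space \<Rightarrow> real) \<Rightarrow> real \<Rightarrow> bool" where
  "polyak_lojasiewicz f \<gamma> \<longleftrightarrow>
     \<gamma> > 0 \<and> (\<forall>x. (norm (grad f x))\<^sup>2 \<ge> \<gamma> * (f x - (INF y. f y)))"

text \<open>
  \<open>indep_vars\<close> requires all variables to have the same value type, so the mutual independence
  of the union of two sequences with different value types is stated for the generated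
  sigma-algebras, exactly as in \<open>indep_vars_def\<close>, over the index type \<open>nat + nat\<close>.
\<close>

definition indep_sequences ::
  "'w measure \<Rightarrow> 'b measure \<Rightarrow> (nat \<Rightarrow> 'w \<Rightarrow> 'b) \<Rightarrow> 'c measure \<Rightarrow> (nat \<Rightarrow> 'w \<Rightarrow> 'c) \<Rightarrow> bool" where
  "indep_sequences M S X T Y \<longleftrightarrow>
     (\<forall>k. X k \<in> measurable M S) \<and> (\<forall>k. Y k \<in> measurable M T) \<and>
     prob_space.indep_sets M
       (case_sum (\<lambda>k. {X k -` E \<inter> space M | E. E \<in> sets S})
                 (\<lambda>k. {Y k -` E \<inter> space M | E. E \<in> sets T})) UNIV"

primrec sszd ::
  "(real ^ 'd \<Rightarrow> 'z \<Rightarrow> real) \<Rightarrow> (nat \<Rightarrow> real) \<Rightarrow> (nat \<Rightarrow> real) \<Rightarrow>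
   (nat \<Rightarrow> 'w \<Rightarrow> real ^ 'l ^ 'd) \<Rightarrow> (nat \<Rightarrow> 'w \<Rightarrow> 'z) \<Rightarrow> real ^ 'd \<Rightarrow> nat \<Rightarrow> 'w \<Rightarrow> real ^ 'd" where
  "sszd F \<alpha> h P Z x0 0 = (\<lambda>\<omega>. x0)"
| "sszd F \<alpha> h P Z x0 (Suc k) = (\<lambda>\<omega>.
     (let x = sszd F \<alpha> h P Z x0 k \<omega>; p = (\<lambda>i. column i (P k \<omega>)); z = Z k \<omega>
      in x - \<alpha> k *\<^sub>R (\<Sum>i\<in>UNIV. ((F (x + h k *\<^sub>R p i) z - F x z) / h k) *\<^sub>R p i)))"

end

theory Submission imports Defs begin

text \<open>
  Fix the current iterate \<open>x\<close> and write \<open>D\<close> for the stochastic gradient at \<open>x\<close> and \<open>v\<close> for the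
  gradient of \<open>f\<close>.  The descent lemma for \<open>F\<close> turns the vector of difference quotients into
  \<open>P\<^sup>T D + e\<close>, where the norm of \<open>e\<close> is at most \<open>h lam d / (2 sqrt l)\<close>, so the step direction is
  \<open>P (P\<^sup>T D + e)\<close>.  The descent lemma for \<open>f\<close>, together with \<open>P\<^sup>T P = (d / l) I\<close>, bounds the next
  value by quadratic forms in \<open>P P\<^sup>T\<close>.  The error term has to be absorbed as the inner product of
  \<open>P\<^sup>T v\<close> and \<open>e\<close>: estimating the norm of \<open>P e\<close> would cost an extra factor \<open>d / l\<close>.  Since \<open>P\<close> and
  \<open>Z\<close> are independent and \<open>P P\<^sup>T\<close> has mean \<open>I\<close>, these forms average to the squared norm of \<open>v\<close> and
  the second moment of \<open>D\<close>, and the ABG and Polyak-Lojasiewicz conditions finish the estimate for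
  fixed \<open>x\<close>.  The \<open>k\<close>-th iterate is independent of \<open>(P k, Z k)\<close>, so the estimate may be integrated
  over its law; working with nonnegative integrals of \<open>f - f*\<close> yields integrability along the way.
\<close>

subsection \<open>Gradients\<close>

text \<open>Existence is the Riesz vector of the derivative, assembled from its values on
  \<open>Basis\<close>; uniqueness of derivatives makes the definite description in
  \<open>grad\<close> well defined.\<close>

lemma GDERIV_grad:
  fixes g :: "'a::euclidean_space \<Rightarrow> real"
  assumes "g differentiable (at x)"
  shows "GDERIV g x :> grad g x"
proof -
  obtain D where D: "(g has_derivative D) (at x)"
    using assms by (auto simp: differentiable_def)
  then have lin: "linear D"
    by (simp add: has_derivative_linear)
  let ?v = "\<Sum>b\<in>Basis. D b *\<^sub>R b"
  have "D = (\<lambda>u. u \<bullet> ?v)"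
  proof
    fix u
    have "D u = D (\<Sum>b\<in>Basis. (u \<bullet> b) *\<^sub>R b)"
      by (simp add: euclidean_representation)
    also have "\<dots> = (\<Sum>b\<in>Basis. (u \<bullet> b) * D b)"
      by (simp add: linear_sum[OF lin] linear_scale[OF lin])
    finally show "D u = u \<bullet> ?v"
      by (simp add: inner_sum_right mult.commute)
  qed
  then have ex: "GDERIV g x :> ?v"
    using D by (simp add: gderiv_def)
  have unique: "v = w" if "GDERIV g x :> v" "GDERIV g x :> w" for v w
  proof -
    have "(\<lambda>u. u \<bullet> v) = (\<lambda>u. u \<bullet> w)"
      using that by (intro has_derivative_unique) (auto simp: gderiv_def)
    then have "\<forall>u. v \<bullet> u = w \<bullet> u"
      by (metis inner_commute)
    then show ?thesis
      by (simp only: vector_eq_ldot vector_eq_rdot)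
  qed
  show ?thesis
    unfolding grad_def by (rule theI[of "\<lambda>D. GDERIV g x :> D", OF ex]) (rule unique[OF _ ex])
qed

lemma grad_eqI:
  fixes g :: "'a::euclidean_space \<Rightarrow> real"
  assumes "GDERIV g x :> v"
  shows "grad g x = v"
proof -
  have "g differentiable (at x)"
    using assms by (auto simp: gderiv_def differentiable_def)
  then have "(\<lambda>u. u \<bullet> grad g x) = (\<lambda>u. u \<bullet> v)"
    using assms GDERIV_grad by (intro has_derivative_unique) (auto simp: gderiv_def)
  then have "\<forall>u. grad g x \<bullet> u = v \<bullet> u"
    by (metis inner_commute)
  then show ?thesis
    by (simp only: vector_eq_ldot vector_eq_rdot)
qed

text \<open>On the segment from \<open>x\<close> to \<open>y\<close>, \<open>g\<close> minus its
  linear part and minus the quadratic term has nonpositive derivative, because the Lipschitz bound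
  at parameter \<open>t\<close> contributes exactly \<open>L * t\<close> times the squared
  length.\<close>

lemma lipschitz_grad_upper:
  fixes g :: "'a::euclidean_space \<Rightarrow> real"
  assumes g: "\<And>x. GDERIV g x :> g' x" and lip: "L-lipschitz_on UNIV g'"
  shows "g y \<le> g x + g' x \<bullet> (y - x) + L / 2 * (norm (y - x))\<^sup>2"
proof -
  let ?u = "y - x"
  let ?\<phi> = "\<lambda>t. g (x + t *\<^sub>R ?u) - t * (g' x \<bullet> ?u) - L / 2 * t\<^sup>2 * (norm ?u)\<^sup>2"
  have "?\<phi> 1 \<le> ?\<phi> 0"
  proof (rule DERIV_nonpos_imp_nonincreasing[of 0 1 ?\<phi>])
    fix t :: real assume t: "0 \<le> t" "t \<le> 1"
    have line: "((\<lambda>t. x + t *\<^sub>R ?u) has_derivative (\<lambda>s. s *\<^sub>R ?u)) (at t)"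
      by (auto intro!: derivative_eq_intros)
    have "((\<lambda>t. g (x + t *\<^sub>R ?u)) has_derivative (\<lambda>s. (s *\<^sub>R ?u) \<bullet> g' (x + t *\<^sub>R ?u))) (at t)"
      using g[of "x + t *\<^sub>R ?u"] unfolding gderiv_def by (rule has_derivative_compose[OF line])
    then have "((\<lambda>t. g (x + t *\<^sub>R ?u)) has_real_derivative ?u \<bullet> g' (x + t *\<^sub>R ?u)) (at t)"
      by (rule has_derivative_imp_has_field_derivative) (simp add: mult.commute)
    then have "(?\<phi> has_real_derivative
        ?u \<bullet> g' (x + t *\<^sub>R ?u) - g' x \<bullet> ?u - L * t * (norm ?u)\<^sup>2) (at t)"
      by (auto intro!: derivative_eq_intros)
    moreover have "?u \<bullet> g' (x + t *\<^sub>R ?u) - g' x \<bullet> ?u \<le> L * t * (norm ?u)\<^sup>2"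
    proof -
      have "?u \<bullet> g' (x + t *\<^sub>R ?u) - g' x \<bullet> ?u = ?u \<bullet> (g' (x + t *\<^sub>R ?u) - g' x)"
        by (simp add: inner_diff_right inner_commute)
      also have "\<dots> \<le> norm ?u * norm (g' (x + t *\<^sub>R ?u) - g' x)"
        by (rule norm_cauchy_schwarz)
      also have "\<dots> \<le> norm ?u * (L * norm (t *\<^sub>R ?u))"
        using lipschitz_onD[OF lip, of "x + t *\<^sub>R ?u" x]
        by (intro mult_left_mono) (auto simp: dist_norm)
      finally show ?thesis
        using t by (simp add: power2_eq_square mult_ac)
    qed
    ultimately show "\<exists>z. (?\<phi> has_real_derivative z) (at t) \<and> z \<le> 0"
      by fastforce
  qed simp
  then show ?thesis
    by (simp add: algebra_simps)
qed

text \<open>The one-sided estimate is applied to \<open>g\<close> and to \<open>- g\<close>.\<close>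

lemma lipschitz_grad_quadratic_bound:
  fixes g :: "'a::euclidean_space \<Rightarrow> real"
  assumes "\<And>x. g differentiable (at x)" and lip: "L-lipschitz_on UNIV (grad g)"
  shows "\<bar>g y - g x - grad g x \<bullet> (y - x)\<bar> \<le> L / 2 * (norm (y - x))\<^sup>2"
proof -
  have "GDERIV (\<lambda>x. - g x) x :> - grad g x" for x
    using assms by (intro GDERIV_minus GDERIV_grad)
  moreover have "L-lipschitz_on UNIV (\<lambda>x. - grad g x)"
    using lip by (simp add: lipschitz_on_minus)
  ultimately have "- g y \<le> - g x + - grad g x \<bullet> (y - x) + L / 2 * (norm (y - x))\<^sup>2"
    by (rule lipschitz_grad_upper)
  moreover have "g y \<le> g x + grad g x \<bullet> (y - x) + L / 2 * (norm (y - x))\<^sup>2"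
    using assms by (intro lipschitz_grad_upper GDERIV_grad)
  ultimately show ?thesis
    by (simp only: abs_le_iff inner_minus_left) linarith
qed

text \<open>Serves to recognise the mean stochastic gradient as the gradient of the objective: a
  quadratic bound survives averaging, so no differentiation under the integral is required.\<close>

lemma GDERIV_if_quadratic_bound:
  fixes g :: "'a::real_inner \<Rightarrow> real"
  assumes "\<And>y. \<bar>g y - g x - v \<bullet> (y - x)\<bar> \<le> K * (norm (y - x))\<^sup>2"
  shows "GDERIV g x :> v"
  unfolding gderiv_def
proof (rule has_derivativeI)
  show "bounded_linear (\<lambda>h. h \<bullet> v)"
    by (rule bounded_linear_inner_left)
  show "((\<lambda>y. ((g y - g x) - (y - x) \<bullet> v) /\<^sub>R norm (y - x)) \<longlongrightarrow> 0) (at x)"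
  proof (rule Lim_null_comparison)
    show "\<forall>\<^sub>F y in at x. norm (((g y - g x) - (y - x) \<bullet> v) /\<^sub>R norm (y - x)) \<le> K * norm (y - x)"
    proof (rule always_eventually, rule allI)
      fix y
      have "norm (((g y - g x) - (y - x) \<bullet> v) /\<^sub>R norm (y - x))
          = \<bar>g y - g x - v \<bullet> (y - x)\<bar> / norm (y - x)"
        by (simp add: inner_commute divide_inverse mult.commute abs_mult)
      also have "\<dots> \<le> K * (norm (y - x))\<^sup>2 / norm (y - x)"
        using assms[of y] by (intro divide_right_mono) auto
      also have "\<dots> = K * norm (y - x)"
        by (simp add: power2_eq_square)
      finally show "norm (((g y - g x) - (y - x) \<bullet> v) /\<^sub>R norm (y - x)) \<le> K * norm (y - x)" .
    qed
    have "((\<lambda>y. K * norm (y - x)) \<longlongrightarrow> K * norm (x - x)) (at x)"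
      by (intro tendsto_intros)
    then show "((\<lambda>y. K * norm (y - x)) \<longlongrightarrow> 0) (at x)"
      by simp
  qed
qed

subsection \<open>Joint measurability\<close>

text \<open>Replacing \<open>y\<close> by a simple approximation leaves only countably many values
  of the first argument, so measurability of each section suffices; continuity in \<open>y\<close>
  carries it to the limit.\<close>

lemma borel_measurable_caratheodory:
  fixes F :: "'a::{metric_space, second_countable_topology} \<Rightarrow> 'z \<Rightarrow> 'b::metric_space"
  assumes meas: "\<And>y. F y \<in> borel_measurable S"
    and cont: "\<And>z. z \<in> space S \<Longrightarrow> continuous_on UNIV (\<lambda>y. F y z)"
  shows "(\<lambda>(y, z). F y z) \<in> borel_measurable (borel \<Otimes>\<^sub>M S)"
proof -
  obtain s :: "nat \<Rightarrow> 'a \<Rightarrow> 'a" where s: "\<And>i. simple_function borel (s i)"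
      "\<And>y. (\<lambda>i. s i y) \<longlonglongrightarrow> y"
    using borel_measurable_implies_sequence_metric[of "\<lambda>y::'a. y" borel undefined] by auto
  show ?thesis
  proof (rule borel_measurable_LIMSEQ_metric)
    fix i
    have fin: "countable (range (s i))"
      using s(1)[of i] by (simp add: simple_function_def countable_finite)
    have "(\<lambda>p. F (s i (fst p)) (snd p)) \<in> borel_measurable (borel \<Otimes>\<^sub>M S)"
    proof (rule measurable_compose_countable'[OF _ _ fin, of "\<lambda>v p. F v (snd p)"])
      show "(\<lambda>p. F v (snd p)) \<in> borel_measurable (borel \<Otimes>\<^sub>M S)" for v
        using meas[of v] by measurable
      have "s i \<in> measurable borel (count_space (range (s i)))"
        using s(1)[of i] by (auto simp: measurable_count_space_eq2 simple_function_def)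
      then show "(\<lambda>p. s i (fst p)) \<in> measurable (borel \<Otimes>\<^sub>M S) (count_space (range (s i)))"
        by measurable
    qed
    then show "(\<lambda>(y, z). F (s i y) z) \<in> borel_measurable (borel \<Otimes>\<^sub>M S)"
      by (simp add: case_prod_beta')
  next
    fix p :: "'a \<times> 'z" assume "p \<in> space (borel \<Otimes>\<^sub>M S)"
    then have "snd p \<in> space S"
      by (auto simp: space_pair_measure)
    then have "isCont (\<lambda>y. F y (snd p)) (fst p)"
      using cont[OF \<open>snd p \<in> space S\<close>] by (simp add: continuous_on_eq_continuous_at)
    then show "(\<lambda>i. case p of (y, z) \<Rightarrow> F (s i y) z) \<longlonglongrightarrow> (case p of (y, z) \<Rightarrow> F y z)"
      using isCont_tendsto_compose[OF _ s(2)[of "fst p"]] by (simp add: case_prod_beta')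
  qed
qed

text \<open>Each coordinate is a pointwise limit of measurable difference quotients with increments
  \<open>1 / real (Suc n)\<close>.\<close>

lemma borel_measurable_grad:
  fixes F :: "'a::euclidean_space \<Rightarrow> 'z \<Rightarrow> real"
  assumes meas: "\<And>y. F y \<in> borel_measurable S"
    and diff: "\<And>z. z \<in> space S \<Longrightarrow> (\<lambda>y. F y z) differentiable (at x)"
  shows "(\<lambda>z. grad (\<lambda>y. F y z) x) \<in> borel_measurable S"
proof (subst borel_measurable_euclidean_space, safe)
  fix b :: 'a assume "b \<in> Basis"
  let ?t = "\<lambda>n. 1 / real (Suc n)"
  show "(\<lambda>z. grad (\<lambda>y. F y z) x \<bullet> b) \<in> borel_measurable S"
  proof (rule borel_measurable_LIMSEQ_metric)
    show "(\<lambda>z. (F (x + ?t n *\<^sub>R b) z - F x z) / ?t n) \<in> borel_measurable S" for n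
      using meas by measurable
  next
    fix z assume z: "z \<in> space S"
    have line: "((\<lambda>t. x + t *\<^sub>R b) has_derivative (\<lambda>s. s *\<^sub>R b)) (at 0)"
      by (auto intro!: derivative_eq_intros)
    have "GDERIV (\<lambda>y. F y z) x :> grad (\<lambda>y. F y z) x"
      using diff[OF z] by (rule GDERIV_grad)
    then have "((\<lambda>t. F (x + t *\<^sub>R b) z) has_derivative (\<lambda>s. (s *\<^sub>R b) \<bullet> grad (\<lambda>y. F y z) x)) (at 0)"
      unfolding gderiv_def by (intro has_derivative_compose[OF line]) simp
    then have "((\<lambda>t. F (x + t *\<^sub>R b) z) has_real_derivative grad (\<lambda>y. F y z) x \<bullet> b) (at 0)"
      by (rule has_derivative_imp_has_field_derivative) (simp add: inner_commute mult.commute)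
    then have lim: "(\<lambda>t. (F (x + t *\<^sub>R b) z - F x z) / t) \<midarrow>0\<rightarrow> grad (\<lambda>y. F y z) x \<bullet> b"
      by (simp add: DERIV_def)
    have "filterlim ?t (at 0) sequentially"
      unfolding filterlim_at using LIMSEQ_inverse_real_of_nat by (simp add: inverse_eq_divide)
    then show "(\<lambda>n. (F (x + ?t n *\<^sub>R b) z - F x z) / ?t n) \<longlonglongrightarrow> grad (\<lambda>y. F y z) x \<bullet> b"
      by (rule filterlim_compose[OF lim])
  qed
qed

subsection \<open>Descent along one step\<close>

lemma inner_matrix_transpose:
  fixes P :: "real ^ 'l ^ 'd"
  shows "u \<bullet> (P *v w) = (transpose P *v u) \<bullet> w"
  by (metis dot_lmul_matrix transpose_matrix_vector)

lemma inner_matrix_mult_transpose: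
  fixes P :: "real ^ 'l ^ 'd"
  shows "((P ** transpose P) *v u) \<bullet> w = (transpose P *v u) \<bullet> (transpose P *v w)"
  by (metis inner_commute inner_matrix_transpose matrix_vector_mul_assoc)

lemma norm_matrix_vector_mult_scaled_isometry:
  fixes P :: "real ^ 'l ^ 'd"
  assumes "transpose P ** P = c *\<^sub>R mat 1"
  shows "(norm (P *v u))\<^sup>2 = c * (norm u)\<^sup>2"
proof -
  have "(norm (P *v u))\<^sup>2 = (transpose P *v (P *v u)) \<bullet> u"
    by (metis inner_matrix_transpose power2_norm_eq_inner)
  also have "\<dots> = (c *\<^sub>R mat 1 *v u) \<bullet> u"
    by (simp add: matrix_vector_mul_assoc assms)
  also have "\<dots> = c * (norm u)\<^sup>2"
    by (simp add: scaleR_matrix_vector_assoc[symmetric] power2_norm_eq_inner)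
  finally show ?thesis .
qed

text \<open>Squared column lengths are the diagonal of the Gram matrix. They fix the length of the
  finite difference directions and hence the discretization error.\<close>

lemma norm_column_scaled_isometry:
  fixes P :: "real ^ 'l ^ 'd"
  assumes "transpose P ** P = c *\<^sub>R mat 1"
  shows "(norm (column i P))\<^sup>2 = c"
proof -
  have "(norm (column i P))\<^sup>2 = (transpose P ** P) $ i $ i"
    by (simp add: matrix_mult_transpose_dot_column power2_norm_eq_inner)
  then show ?thesis
    by (simp add: assms mat_def)
qed

text \<open>One update as a deterministic function of point, matrix and sample, so that it can be
  averaged over the last two with the point frozen.\<close>

definition sszd_step ::
  "(real ^ 'd \<Rightarrow> 'z \<Rightarrow> real) \<Rightarrow> real \<Rightarrow> real \<Rightarrow> real ^ 'd \<Rightarrow> real ^ 'l ^ 'd \<Rightarrow> 'z \<Rightarrow> real ^ 'd" where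
  "sszd_step F a h x P z =
     x - a *\<^sub>R (\<Sum>i\<in>UNIV. ((F (x + h *\<^sub>R column i P) z - F x z) / h) *\<^sub>R column i P)"

lemma sszd_Suc:
  "sszd F \<alpha> h P Z x0 (Suc k) \<omega> =
     sszd_step F (\<alpha> k) (h k) (sszd F \<alpha> h P Z x0 k \<omega>) (P k \<omega>) (Z k \<omega>)"
  by (simp add: sszd_step_def Let_def)

text \<open>Pathwise estimate for one matrix and one sample. The three forms in
  \<open>P ** transpose P\<close> are left unestimated because only their expectations
  simplify.\<close>

lemma sszd_step_descent:
  fixes F :: "real ^ 'd \<Rightarrow> 'z \<Rightarrow> real" and P :: "real ^ 'l ^ 'd" and f :: "real ^ 'd \<Rightarrow> real"
    and d l :: real
  defines "d \<equiv> real CARD('d)" and "l \<equiv> real CARD('l)"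
  assumes F: "\<And>y. \<bar>F y z - F x z - D \<bullet> (y - x)\<bar> \<le> lam / 2 * (norm (y - x))\<^sup>2"
    and f: "\<And>y. f y \<le> f x + v \<bullet> (y - x) + lam / 2 * (norm (y - x))\<^sup>2"
    and P: "transpose P ** P = (d / l) *\<^sub>R mat 1"
    and pos: "0 < a" "0 < h" "0 < lam"
  shows "f (sszd_step F a h x P z) \<le>
      f x - a * (((P ** transpose P) *v D) \<bullet> v) + a / 2 * (((P ** transpose P) *v v) \<bullet> v)
      + lam * d / l * a\<^sup>2 * (((P ** transpose P) *v D) \<bullet> D)
      + a * h\<^sup>2 * (lam * d / (2 * sqrt l))\<^sup>2 * (1 / 2 + lam * d / l * a)"
proof -
  let ?p = "\<lambda>i. column i P"
  define c where "c = d / l"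
  have l: "0 < l" and c: "0 \<le> c"
    by (simp_all add: l_def d_def c_def)
  define q :: "real ^ 'l" where "q = (\<chi> i. (F (x + h *\<^sub>R ?p i) z - F x z) / h)"
  define s where "s = transpose P *v D"
  define t where "t = transpose P *v v"
  define e where "e = q - s"
  have s_nth: "s $ i = D \<bullet> ?p i" for i
    by (simp add: s_def matrix_vector_mult_def transpose_def column_def inner_vec_def mult.commute)
  \<comment> \<open>The remainder of \<open>F\<close> over a displacement of squared length
    \<open>h\<^sup>2 * c\<close> is divided by \<open>h\<close>.\<close>
  have e_nth: "\<bar>e $ i\<bar> \<le> lam * h * c / 2" for i
  proof -
    have "e $ i = (F (x + h *\<^sub>R ?p i) z - F x z - D \<bullet> (h *\<^sub>R ?p i)) / h"
      using pos by (simp add: e_def q_def s_nth field_simps)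
    also have "\<bar>\<dots>\<bar> = \<bar>F (x + h *\<^sub>R ?p i) z - F x z - D \<bullet> (h *\<^sub>R ?p i)\<bar> / h"
      using pos by (simp add: abs_divide)
    also have "\<dots> \<le> lam / 2 * (norm (h *\<^sub>R ?p i))\<^sup>2 / h"
      using F[of "x + h *\<^sub>R ?p i"] pos by (intro divide_right_mono) auto
    also have "\<dots> = lam * h * c / 2"
      using pos norm_column_scaled_isometry[OF P, of i]
      by (simp add: power_mult_distrib c_def power2_eq_square field_simps)
    finally show ?thesis .
  qed
  \<comment> \<open>This is \<open>l\<close> times the square of the coordinate bound
    \<open>lam * h * d / (2 * l)\<close>, which is where \<open>sqrt l\<close> comes from.\<close>
  define E where "E = h\<^sup>2 * (lam * d / (2 * sqrt l))\<^sup>2"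
  have e: "(norm e)\<^sup>2 \<le> E"
  proof -
    have "(norm e)\<^sup>2 = (\<Sum>i\<in>UNIV. (e $ i)\<^sup>2)"
      by (simp only: power2_norm_eq_inner inner_vec_def) (simp add: power2_eq_square)
    also have "\<dots> \<le> (\<Sum>i\<in>(UNIV::'l set). (lam * h * c / 2)\<^sup>2)"
      using e_nth by (intro sum_mono abs_le_square_iff[THEN iffD1]) (meson abs_ge_self order_trans)
    also have "\<dots> = E"
      using l by (simp add: E_def c_def power_mult_distrib power_divide flip: l_def)
        (simp add: power2_eq_square mult_ac)
    finally show ?thesis .
  qed
  \<comment> \<open>A weighted sum of columns is the matrix applied to the weights, here
    \<open>q = s + e\<close>.\<close>
  have step: "sszd_step F a h x P z - x = - a *\<^sub>R (P *v (s + e))"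
    by (simp add: sszd_step_def e_def matrix_mult_sum q_def scalar_mult_eq_scaleR)
  have "f (sszd_step F a h x P z) \<le>
      f x + v \<bullet> (- a *\<^sub>R (P *v (s + e))) + lam / 2 * (norm (- a *\<^sub>R (P *v (s + e))))\<^sup>2"
    using f[of "sszd_step F a h x P z"] by (simp only: step)
  also have "v \<bullet> (- a *\<^sub>R (P *v (s + e))) = - a * (t \<bullet> s) - a * (t \<bullet> e)"
    by (simp add: inner_matrix_transpose flip: t_def del: transpose_matrix_vector)
      (simp add: inner_add_right algebra_simps)
  also have "(norm (- a *\<^sub>R (P *v (s + e))))\<^sup>2 = a\<^sup>2 * (c * (norm (s + e))\<^sup>2)"
    using norm_matrix_vector_mult_scaled_isometry[OF P] by (simp add: power_mult_distrib c_def)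
  finally have *: "f (sszd_step F a h x P z) \<le>
      f x + (- a * (t \<bullet> s) - a * (t \<bullet> e)) + lam / 2 * (a\<^sup>2 * (c * (norm (s + e))\<^sup>2))" .
  \<comment> \<open>The first square gives Young's inequality for the cross term; the second splits
    \<open>norm (s + e)\<close> at the price of a factor 2, which cancels the half in
    \<open>lam / 2\<close>.\<close>
  have "0 \<le> (norm (t + e))\<^sup>2" "0 \<le> (norm (s - e))\<^sup>2"
    by simp_all
  then have "- (t \<bullet> e) \<le> ((norm t)\<^sup>2 + (norm e)\<^sup>2) / 2"
      and "(norm (s + e))\<^sup>2 \<le> 2 * ((norm s)\<^sup>2 + (norm e)\<^sup>2)"
    by (simp_all add: power2_norm_eq_inner inner_add_left inner_add_right inner_diff_left
        inner_diff_right inner_commute)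
  with e have te: "- (t \<bullet> e) \<le> ((norm t)\<^sup>2 + E) / 2"
      and se: "(norm (s + e))\<^sup>2 \<le> 2 * ((norm s)\<^sup>2 + E)"
    by auto
  have "- a * (t \<bullet> e) \<le> a * (((norm t)\<^sup>2 + E) / 2)"
    using mult_left_mono[OF te, of a] pos by simp
  moreover have "lam / 2 * (a\<^sup>2 * (c * (norm (s + e))\<^sup>2)) \<le> lam / 2 * (a\<^sup>2 * (c * (2 * ((norm s)\<^sup>2 + E))))"
    using pos c by (intro mult_left_mono se) auto
  ultimately have "f (sszd_step F a h x P z) \<le> f x - a * (t \<bullet> s)
      + a * (((norm t)\<^sup>2 + E) / 2) + lam / 2 * (a\<^sup>2 * (c * (2 * ((norm s)\<^sup>2 + E))))"
    using * by linarith
  also have "\<dots> = f x - a * (s \<bullet> t) + a / 2 * (t \<bullet> t) + lam * c * a\<^sup>2 * (s \<bullet> s) + a * E * (1 / 2 + lam * c * a)"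
    unfolding power2_norm_eq_inner
    by (simp add: inner_commute algebra_simps power2_eq_square add_divide_distrib)
  finally show ?thesis
    by (simp add: inner_matrix_mult_transpose s_def t_def c_def E_def mult.assoc)
qed

subsection \<open>Independence and quadratic forms\<close>

text \<open>
  Independence is stated for the generated set systems because \<^const>\<open>prob_space.indep_var\<close>
  forces both variables to have the same value type.
\<close>

lemma (in prob_space) indep_var_comp_if_indep_set:
  assumes indep: "indep_set {X -` A \<inter> space M |A. A \<in> sets S} {Y -` B \<inter> space M |B. B \<in> sets T}"
    and X: "X \<in> measurable M S" and Y: "Y \<in> measurable M T"
    and g: "g \<in> measurable S N" and h: "h \<in> measurable T N'"
  shows "indep_var N (\<lambda>\<omega>. g (X \<omega>)) N' (\<lambda>\<omega>. h (Y \<omega>))"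
  unfolding indep_var_def indep_vars_def2
proof (intro conjI ballI)
  fix b :: bool
  show "random_variable (case b of True \<Rightarrow> N | False \<Rightarrow> N')
      (case b of True \<Rightarrow> \<lambda>\<omega>. g (X \<omega>) | False \<Rightarrow> \<lambda>\<omega>. h (Y \<omega>))"
    using X Y g h by (cases b) auto
next
  have sub: "{(\<lambda>\<omega>. k (V \<omega>)) -` A \<inter> space M |A. A \<in> sets K} \<subseteq> {V -` A \<inter> space M |A. A \<in> sets L}"
    if V: "V \<in> measurable M L" and k: "k \<in> measurable L K" for V k L K
  proof safe
    fix A assume "A \<in> sets K"
    then show "\<exists>B. (\<lambda>\<omega>. k (V \<omega>)) -` A \<inter> space M = V -` B \<inter> space M \<and> B \<in> sets L"
      using measurable_sets[OF k] measurable_space[OF V]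
      by (intro exI[of _ "k -` A \<inter> space L"]) auto
  qed
  show "indep_sets (\<lambda>b. {(case b of True \<Rightarrow> \<lambda>\<omega>. g (X \<omega>) | False \<Rightarrow> \<lambda>\<omega>. h (Y \<omega>)) -` A \<inter> space M |A.
      A \<in> sets (case b of True \<Rightarrow> N | False \<Rightarrow> N')}) UNIV"
    using sub[OF X g] sub[OF Y h]
    by (intro indep_sets_mono_sets[OF indep[unfolded indep_set_def]]) (simp split: bool.split)
qed

text \<open>Independence is the product rule on measurable rectangles, and these determine the joint
  law.\<close>

lemma (in prob_space) distr_pair_if_indep_set:
  assumes indep: "indep_set {X -` A \<inter> space M |A. A \<in> sets S} {Y -` B \<inter> space M |B. B \<in> sets T}"
    and X: "X \<in> measurable M S" and Y: "Y \<in> measurable M T"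
  shows "distr M S X \<Otimes>\<^sub>M distr M T Y = distr M (S \<Otimes>\<^sub>M T) (\<lambda>\<omega>. (X \<omega>, Y \<omega>))"
proof (rule pair_measure_eqI)
  show "sigma_finite_measure (distr M S X)" "sigma_finite_measure (distr M T Y)"
    using prob_space_distr[OF X] prob_space_distr[OF Y]
    by (simp_all add: prob_space_imp_sigma_finite)
  fix A B assume AB: "A \<in> sets (distr M S X)" "B \<in> sets (distr M T Y)"
  have "prob ((X -` A \<inter> space M) \<inter> (Y -` B \<inter> space M)) = prob (X -` A \<inter> space M) * prob (Y -` B \<inter> space M)"
    using AB by (intro indep_setD[OF indep]) auto
  moreover have "(\<lambda>\<omega>. (X \<omega>, Y \<omega>)) -` (A \<times> B) \<inter> space M = (X -` A \<inter> space M) \<inter> (Y -` B \<inter> space M)"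
    by auto
  ultimately show "emeasure (distr M S X) A * emeasure (distr M T Y) B
      = emeasure (distr M (S \<Otimes>\<^sub>M T) (\<lambda>\<omega>. (X \<omega>, Y \<omega>))) (A \<times> B)"
    using AB X Y by (simp add: emeasure_distr emeasure_eq_measure ennreal_mult)
qed simp

text \<open>Expanded in entries, every summand is an entry of \<open>Q\<close> times a function of
  \<open>W\<close>. Independence factorizes its mean, and the identity matrix retains only the
  diagonal summands.\<close>

lemma (in prob_space)
  fixes Q :: "'x \<Rightarrow> real ^ 'd ^ 'd" and u w :: "'z \<Rightarrow> real ^ 'd"
  assumes indep: "indep_set {X -` A \<inter> space M |A. A \<in> sets T} {W -` B \<inter> space M |B. B \<in> sets S}"
    and rv: "X \<in> measurable M T" "W \<in> measurable M S" and Q: "expectation (\<lambda>\<omega>. Q (X \<omega>)) = mat 1"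
    and meas: "Q \<in> borel_measurable T" "u \<in> borel_measurable S" "w \<in> borel_measurable S"
    and int: "\<And>i j. integrable M (\<lambda>\<omega>. u (W \<omega>) $ i * w (W \<omega>) $ j)"
  shows integrable_indep_quadratic_form: "integrable M (\<lambda>\<omega>. (Q (X \<omega>) *v u (W \<omega>)) \<bullet> w (W \<omega>))"
    and expectation_indep_quadratic_form:
      "expectation (\<lambda>\<omega>. (Q (X \<omega>) *v u (W \<omega>)) \<bullet> w (W \<omega>)) = expectation (\<lambda>\<omega>. u (W \<omega>) \<bullet> w (W \<omega>))"
proof -
  have form: "(Q (X \<omega>) *v u (W \<omega>)) \<bullet> w (W \<omega>)
      = (\<Sum>j\<in>UNIV. \<Sum>i\<in>UNIV. Q (X \<omega>) $ j $ i * (u (W \<omega>) $ i * w (W \<omega>) $ j))" for \<omega>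
    by (simp add: inner_vec_def matrix_vector_mult_def sum_distrib_left sum_distrib_right mult_ac)
  \<comment> \<open>The Bochner integral of a non-integrable function is 0, so a nonzero expectation
    forces integrability of \<open>Q\<close>.\<close>
  have "(mat 1 :: real ^ 'd ^ 'd) \<noteq> 0"
    by (simp add: vec_eq_iff mat_def)
  then have Q_int: "integrable M (\<lambda>\<omega>. Q (X \<omega>))"
    using Q not_integrable_integral_eq by metis
  have bl: "bounded_linear (\<lambda>A :: real ^ 'd ^ 'd. A $ j $ i)" for i j
    by (rule bounded_linear_compose[OF bounded_linear_vec_nth bounded_linear_vec_nth])
  have Qji_int: "integrable M (\<lambda>\<omega>. Q (X \<omega>) $ j $ i)" for i j
    using integrable_bounded_linear[OF bl Q_int] .
  have Qji: "expectation (\<lambda>\<omega>. Q (X \<omega>) $ j $ i) = (if i = j then 1 else 0)" for i j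
    using integral_bounded_linear[OF bl Q_int, of j i] by (simp add: Q mat_def)
  have ind: "indep_var borel (\<lambda>\<omega>. Q (X \<omega>) $ j $ i) borel (\<lambda>\<omega>. u (W \<omega>) $ i * w (W \<omega>) $ j)" for i j
  proof -
    have "(\<lambda>x. Q x $ j $ i) \<in> borel_measurable T"
      using bl meas(1)
      by (intro measurable_compose[OF meas(1)] borel_measurable_continuous_onI linear_continuous_on)
    moreover have "(\<lambda>z. u z $ i * w z $ j) \<in> borel_measurable S"
      using meas(2,3) by (auto intro!: borel_measurable_times measurable_compose[OF _ borel_measurable_nth])
    ultimately show ?thesis
      by (rule indep_var_comp_if_indep_set[OF indep rv])
  qed
  note term_int = indep_var_integrable[OF ind Qji_int int]
  note term_eq = indep_var_lebesgue_integral[OF ind Qji_int int]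
  show "integrable M (\<lambda>\<omega>. (Q (X \<omega>) *v u (W \<omega>)) \<bullet> w (W \<omega>))"
    unfolding form by (intro Bochner_Integration.integrable_sum term_int)
  have "expectation (\<lambda>\<omega>. (Q (X \<omega>) *v u (W \<omega>)) \<bullet> w (W \<omega>))
      = (\<Sum>j\<in>UNIV. \<Sum>i\<in>UNIV. expectation (\<lambda>\<omega>. Q (X \<omega>) $ j $ i * (u (W \<omega>) $ i * w (W \<omega>) $ j)))"
    unfolding form
    by (simp add: term_int Bochner_Integration.integral_sum Bochner_Integration.integrable_sum)
  also have "\<dots> = (\<Sum>j\<in>UNIV. \<Sum>i\<in>UNIV.
      (if i = j then expectation (\<lambda>\<omega>. u (W \<omega>) $ i * w (W \<omega>) $ j) else 0))"
    unfolding term_eq Qji by (intro sum.cong) auto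
  also have "\<dots> = (\<Sum>j\<in>UNIV. expectation (\<lambda>\<omega>. u (W \<omega>) $ j * w (W \<omega>) $ j))"
    by simp
  also have "\<dots> = expectation (\<lambda>\<omega>. u (W \<omega>) \<bullet> w (W \<omega>))"
    by (simp add: inner_vec_def int Bochner_Integration.integral_sum)
  finally show "expectation (\<lambda>\<omega>. (Q (X \<omega>) *v u (W \<omega>)) \<bullet> w (W \<omega>)) = expectation (\<lambda>\<omega>. u (W \<omega>) \<bullet> w (W \<omega>))" .
qed

subsection \<open>The expected descent from a fixed point\<close>

text \<open>The assumption is stated for \<open>Z\<close> while the iteration draws copies of it;
  every clause involving the random variable depends on its law only.\<close>

lemma smoothness_ABG_cong_distr:
  fixes F :: "'a::euclidean_space \<Rightarrow> 'z \<Rightarrow> real"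
  assumes Z: "Z \<in> measurable M S" and W: "W \<in> measurable M S"
    and distr: "distr M S W = distr M S Z"
    and F: "\<And>y. F y \<in> borel_measurable S"
    and ABG: "smoothness_ABG M S F Z lam A B G"
  shows "objective M F W = objective M F Z" and "smoothness_ABG M S F W lam A B G"
proof -
  have int_eq: "(\<integral>\<omega>. g (W \<omega>) \<partial>M) = (\<integral>\<omega>. g (Z \<omega>) \<partial>M)"
      and integrable_eq: "integrable M (\<lambda>\<omega>. g (W \<omega>)) \<longleftrightarrow> integrable M (\<lambda>\<omega>. g (Z \<omega>))"
    if "g \<in> borel_measurable S" for g :: "'z \<Rightarrow> real"
    using integral_distr[OF W that] integral_distr[OF Z that] integrable_distr_eq[OF W that]
      integrable_distr_eq[OF Z that] by (simp_all add: distr)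
  have nn_eq: "(\<integral>\<^sup>+\<omega>. g (W \<omega>) \<partial>M) = (\<integral>\<^sup>+\<omega>. g (Z \<omega>) \<partial>M)"
    if "g \<in> borel_measurable S" for g
    using nn_integral_distr[OF W, of g] nn_integral_distr[OF Z, of g] that by (simp add: distr)
  show obj: "objective M F W = objective M F Z"
    by (auto simp: objective_def int_eq F)
  \<comment> \<open>Moving the second moment to another variable with the same law goes through
    \<open>nn_integral_distr\<close>, which asks for this measurability.\<close>
  have "(\<lambda>z. ennreal ((norm (grad (\<lambda>y. F y z) x))\<^sup>2)) \<in> borel_measurable S" for x
    using ABG by (intro measurable_compose[OF _ measurable_ennreal] borel_measurable_power
        measurable_compose[OF _ borel_measurable_norm] borel_measurable_grad F) (simp add: smoothness_ABG_def Let_def)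
  note grad_eq = nn_eq[OF this]
  show "smoothness_ABG M S F W lam A B G"
    using ABG by (simp add: smoothness_ABG_def Let_def obj grad_eq integrable_eq F)
qed

text \<open>Joint measurability of \<open>F\<close> enters because the evaluation points are
  themselves random.\<close>

lemma borel_measurable_sszd_step:
  fixes F :: "real ^ 'd \<Rightarrow> 'z \<Rightarrow> real" and P :: "'a \<Rightarrow> real ^ 'l ^ 'd"
  assumes F: "(\<lambda>(y, z). F y z) \<in> borel_measurable (borel \<Otimes>\<^sub>M S)"
    and X: "X \<in> borel_measurable N" and P: "P \<in> borel_measurable N" and Z: "Z \<in> measurable N S"
  shows "(\<lambda>\<omega>. sszd_step F a h (X \<omega>) (P \<omega>) (Z \<omega>)) \<in> borel_measurable N"
proof -
  have column: "(\<lambda>\<omega>. column i (P \<omega>)) \<in> borel_measurable N" for i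
  proof (rule measurable_compose[OF P])
    show "column i \<in> borel_measurable (borel :: (real ^ 'l ^ 'd) measure)"
      unfolding column_def by (intro borel_measurable_continuous_onI continuous_intros)
  qed
  have F': "(\<lambda>\<omega>. F (Y \<omega>) (Z \<omega>)) \<in> borel_measurable N" if "Y \<in> borel_measurable N" for Y
    using measurable_compose[OF measurable_Pair[OF that Z] F] by simp
  show ?thesis
    unfolding sszd_step_def using X column
    by (intro borel_measurable_diff borel_measurable_scaleR borel_measurable_sum borel_measurable_divide
        borel_measurable_add F' borel_measurable_const)
qed

context prob_space
begin

text \<open>Averaging the uniform quadratic bound of \<open>F\<close> over the sample gives the same
  bound for \<open>f\<close>, with the mean of the stochastic gradient as linear coefficient. That
  mean is therefore the gradient of \<open>f\<close>, and \<open>f\<close> inherits the constant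
  \<open>lam\<close>.\<close>

lemma smoothness_ABG_gradient_moments:
  fixes F :: "'d::euclidean_space \<Rightarrow> 'z \<Rightarrow> real" and Z :: "'a \<Rightarrow> 'z" and f :: "'d \<Rightarrow> real"
  defines "f \<equiv> objective M F Z"
  assumes Z: "Z \<in> measurable M S" and F: "\<And>y. F y \<in> borel_measurable S"
    and ABG: "smoothness_ABG M S F Z lam A B G"
  shows integrable_stochastic_grad: "integrable M (\<lambda>\<omega>. grad (\<lambda>y. F y (Z \<omega>)) x)"
    and integrable_norm_stochastic_grad: "integrable M (\<lambda>\<omega>. (norm (grad (\<lambda>y. F y (Z \<omega>)) x))\<^sup>2)"
    and expectation_norm_stochastic_grad: "expectation (\<lambda>\<omega>. (norm (grad (\<lambda>y. F y (Z \<omega>)) x))\<^sup>2)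
      \<le> A * (f x - (INF y. f y)) + B * (norm (grad f x))\<^sup>2 + G"
    and expectation_stochastic_grad: "expectation (\<lambda>\<omega>. grad (\<lambda>y. F y (Z \<omega>)) x) = grad f x"
    and objective_quadratic_bound: "\<bar>f y - f x - grad f x \<bullet> (y - x)\<bar> \<le> lam / 2 * (norm (y - x))\<^sup>2"
    and objective_ge_INF: "(INF y. f y) \<le> f x"
proof -
  have smooth: "(\<lambda>y. F y z) differentiable (at x)" "lam-lipschitz_on UNIV (grad (\<lambda>y. F y z))"
      if "z \<in> space S" for z x
    using ABG that by (auto simp: smoothness_ABG_def Let_def)
  have F_int: "integrable M (\<lambda>\<omega>. F x (Z \<omega>))"
    and minimizer: "\<exists>x. \<forall>y. f x \<le> f y"
    and pos: "0 < A" "0 < B" "0 < G"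
    and moment: "(\<integral>\<^sup>+\<omega>. ennreal ((norm (grad (\<lambda>y. F y (Z \<omega>)) x))\<^sup>2) \<partial>M)
              \<le> ennreal (A * (f x - (INF y. f y)) + B * (norm (grad f x))\<^sup>2 + G)" for x
    using ABG by (auto simp: smoothness_ABG_def f_def Let_def)
  have "bdd_below (range f)"
    using minimizer by (auto simp: bdd_below_def)
  then show min: "(INF y. f y) \<le> f x" for x
    by (intro cINF_lower) auto
  let ?D = "\<lambda>x \<omega>. grad (\<lambda>y. F y (Z \<omega>)) x"
  have D_meas: "?D x \<in> borel_measurable M" for x
    using borel_measurable_grad[OF F smooth(1)] Z by (rule measurable_compose[rotated])
  show sq_int: "integrable M (\<lambda>\<omega>. (norm (?D x \<omega>))\<^sup>2)" for x
  proof (rule integrableI_nonneg)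
    show "(\<lambda>\<omega>. (norm (?D x \<omega>))\<^sup>2) \<in> borel_measurable M"
      using D_meas[of x] by (intro borel_measurable_power measurable_compose[OF _ borel_measurable_norm])
    show "(\<integral>\<^sup>+\<omega>. ennreal ((norm (?D x \<omega>))\<^sup>2) \<partial>M) < \<infinity>"
      by (rule le_less_trans[OF moment]) simp
  qed simp
  have "ennreal (expectation (\<lambda>\<omega>. (norm (?D x \<omega>))\<^sup>2))
      \<le> ennreal (A * (f x - (INF y. f y)) + B * (norm (grad f x))\<^sup>2 + G)"
    using moment[of x] nn_integral_eq_integral[OF sq_int[of x]] by simp
  \<comment> \<open>\<open>ennreal\<close> sends negative numbers to 0, so this is checked before
    returning to the reals.\<close>
  moreover have "0 \<le> A * (f x - (INF y. f y)) + B * (norm (grad f x))\<^sup>2 + G"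
    using pos min[of x] by simp
  ultimately show "expectation (\<lambda>\<omega>. (norm (?D x \<omega>))\<^sup>2)
      \<le> A * (f x - (INF y. f y)) + B * (norm (grad f x))\<^sup>2 + G"
    by (simp add: ennreal_le_iff)
  \<comment> \<open>On a probability space a finite second moment implies a finite first
    moment.\<close>
  have "integrable M (\<lambda>\<omega>. norm (?D x \<omega>))" for x
    using D_meas[of x] sq_int[of x] by (rule square_integrable_imp_integrable[OF measurable_compose[OF _ borel_measurable_norm]])
  then show D_int: "integrable M (?D x)" for x
    using integrable_norm_iff[OF D_meas[of x]] by simp
  have quad: "\<bar>f y - f x - expectation (?D x) \<bullet> (y - x)\<bar> \<le> lam / 2 * (norm (y - x))\<^sup>2" for x y
  proof -
    let ?r = "\<lambda>\<omega>. F y (Z \<omega>) - F x (Z \<omega>) - ?D x \<omega> \<bullet> (y - x)"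
    have r_int: "integrable M ?r"
      using F_int D_int by (intro Bochner_Integration.integrable_diff integrable_inner_left) auto
    have "f y - f x - expectation (?D x) \<bullet> (y - x) = expectation ?r"
      using F_int D_int[of x] by (simp add: f_def objective_def)
    also have "\<bar>\<dots>\<bar> \<le> expectation (\<lambda>\<omega>. \<bar>?r \<omega>\<bar>)"
      by (rule integral_abs_bound)
    also have "\<dots> \<le> expectation (\<lambda>\<omega>. lam / 2 * (norm (y - x))\<^sup>2)"
      using smooth measurable_space[OF Z] r_int
      by (intro integral_mono lipschitz_grad_quadratic_bound) auto
    finally show ?thesis
      by (simp add: prob_space)
  qed
  show grad_f: "expectation (?D x) = grad f x" for x
    using grad_eqI[OF GDERIV_if_quadratic_bound[OF quad[of _ x]]] by simp
  show "\<bar>f y - f x - grad f x \<bullet> (y - x)\<bar> \<le> lam / 2 * (norm (y - x))\<^sup>2" for x y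
    using quad[of y x] by (simp only: grad_f)
qed

text \<open>The nonnegative integral is meaningful before integrability of the next value is known.
  \<open>0 \<le> R\<close> is recorded so that \<open>ennreal R\<close> really stands for
  \<open>R\<close>; it holds because \<open>R\<close> dominates the mean of an almost surely
  nonnegative function.\<close>

lemma sszd_step_expected_descent:
  fixes F :: "real ^ 'd \<Rightarrow> 'z \<Rightarrow> real" and P :: "'a \<Rightarrow> real ^ 'l ^ 'd"
    and Z :: "'a \<Rightarrow> 'z" and f :: "real ^ 'd \<Rightarrow> real" and x :: "real ^ 'd"
    and a h abar lam A B G \<gamma> d l fstar R :: real
  defines "d \<equiv> real CARD('d)" and "l \<equiv> real CARD('l)"
    and "f \<equiv> objective M F Z" and "fstar \<equiv> (INF y. f y)"
    and "R \<equiv> (1 - a * (\<gamma> / 2 - d * lam * (A + \<gamma> * B) / l * abar)) * (f x - fstar)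
      + (lam * d / l * a\<^sup>2 * G + a * h\<^sup>2 * (lam * d / (2 * sqrt l))\<^sup>2 * (1 / 2 + lam * d / l * a))"
  assumes P: "P \<in> borel_measurable M" and Z: "Z \<in> measurable M S"
    and F: "\<And>y. F y \<in> borel_measurable S"
    and ABG: "smoothness_ABG M S F Z lam A B G" and PL: "polyak_lojasiewicz f \<gamma>"
    and indep: "indep_set {P -` E \<inter> space M |E. E \<in> sets borel} {Z -` E \<inter> space M |E. E \<in> sets S}"
    and PPt: "expectation (\<lambda>\<omega>. P \<omega> ** transpose (P \<omega>)) = mat 1"
    and PtP: "AE \<omega> in M. transpose (P \<omega>) ** P \<omega> = (d / l) *\<^sub>R mat 1"
    and a: "0 < a" "a \<le> abar" and h: "0 < h" and abar: "2 * abar * d * lam * B / l \<le> 1"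
  shows "0 \<le> R"
    and "(\<integral>\<^sup>+\<omega>. ennreal (f (sszd_step F a h x (P \<omega>) (Z \<omega>)) - fstar) \<partial>M) \<le> ennreal R"
proof -
  have l: "0 < l" and d: "0 < d"
    by (simp_all add: l_def d_def)
  have lam: "0 < lam" and AB: "0 < A" "0 < B"
    using ABG by (auto simp: smoothness_ABG_def Let_def)
  have smooth: "(\<lambda>y. F y z) differentiable (at x)" "lam-lipschitz_on UNIV (grad (\<lambda>y. F y z))"
      if "z \<in> space S" for z x
    using ABG that by (auto simp: smoothness_ABG_def Let_def)
  define D where "D z = grad (\<lambda>y. F y z) x" for z
  define v where "v = grad f x"
  have D_meas: "D \<in> borel_measurable S"
    unfolding D_def using F smooth(1) by (rule borel_measurable_grad)
  note moments = smoothness_ABG_gradient_moments[OF Z F ABG, folded f_def]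
  have D_int: "integrable M (\<lambda>\<omega>. D (Z \<omega>))" and ED: "expectation (\<lambda>\<omega>. D (Z \<omega>)) = v"
    and D2_int: "integrable M (\<lambda>\<omega>. (norm (D (Z \<omega>)))\<^sup>2)"
    and ED2: "expectation (\<lambda>\<omega>. (norm (D (Z \<omega>)))\<^sup>2) \<le> A * (f x - fstar) + B * (norm v)\<^sup>2 + G"
    using moments(1,2,3,4)[of x] by (simp_all add: D_def v_def fstar_def)
  have min: "fstar \<le> f y" for y
    using moments(6)[of y] by (simp add: fstar_def)
  let ?Q = "\<lambda>P :: real ^ 'l ^ 'd. P ** transpose P"
  have Q_meas: "?Q \<in> borel_measurable borel"
    unfolding matrix_matrix_mult_def transpose_def
    by (intro borel_measurable_continuous_onI continuous_intros)
  have comp_int: "integrable M (\<lambda>\<omega>. D (Z \<omega>) $ i)" for i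
    using D_int by (rule integrable_bounded_linear[OF bounded_linear_vec_nth])
  have prod_int: "integrable M (\<lambda>\<omega>. D (Z \<omega>) $ i * D (Z \<omega>) $ j)" for i j
  proof (rule Bochner_Integration.integrable_bound[OF D2_int])
    show "(\<lambda>\<omega>. D (Z \<omega>) $ i * D (Z \<omega>) $ j) \<in> borel_measurable M"
      using comp_int by (intro borel_measurable_times) auto
    have "\<bar>D (Z \<omega>) $ i\<bar> * \<bar>D (Z \<omega>) $ j\<bar> \<le> norm (D (Z \<omega>)) * norm (D (Z \<omega>))" for \<omega>
      by (intro mult_mono component_le_norm_cart) auto
    then show "AE \<omega> in M. norm (D (Z \<omega>) $ i * D (Z \<omega>) $ j) \<le> norm ((norm (D (Z \<omega>)))\<^sup>2)"
      by (simp add: abs_mult power2_eq_square)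
  qed
  note form_int = integrable_indep_quadratic_form[OF indep P Z PPt Q_meas]
  note form_eq = expectation_indep_quadratic_form[OF indep P Z PPt Q_meas]
  let ?Dv = "\<lambda>\<omega>. (?Q (P \<omega>) *v D (Z \<omega>)) \<bullet> v" and ?vv = "\<lambda>\<omega>. (?Q (P \<omega>) *v v) \<bullet> v"
    and ?DD = "\<lambda>\<omega>. (?Q (P \<omega>) *v D (Z \<omega>)) \<bullet> D (Z \<omega>)"
  \<comment> \<open>All three are instances of one lemma, with the constant function
    \<open>v\<close> in one slot, both or neither.\<close>
  have ints: "integrable M ?Dv" "integrable M ?vv" "integrable M ?DD"
    using form_int[of D "\<lambda>_. v"] form_int[of "\<lambda>_. v" "\<lambda>_. v"] form_int[of D D]
      D_meas comp_int prod_int by simp_all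
  have E_Dv: "expectation ?Dv = (norm v)\<^sup>2"
    using form_eq[of D "\<lambda>_. v"] D_meas comp_int D_int by (simp add: ED power2_norm_eq_inner)
  have E_vv: "expectation ?vv = (norm v)\<^sup>2"
    using form_eq[of "\<lambda>_. v" "\<lambda>_. v"] by (simp add: power2_norm_eq_inner prob_space)
  have E_DD: "expectation ?DD \<le> A * (f x - fstar) + B * (norm v)\<^sup>2 + G"
    using form_eq[of D D] D_meas prod_int ED2 by (simp add: power2_norm_eq_inner)
  define K where "K = a * h\<^sup>2 * (lam * d / (2 * sqrt l))\<^sup>2 * (1 / 2 + lam * d / l * a)"
  \<comment> \<open>An integrable majorant of the next optimality gap, with the quadratic forms
    still random.\<close>
  define U where "U \<omega> = f x - a * ?Dv \<omega> + a / 2 * ?vv \<omega> + lam * d / l * a\<^sup>2 * ?DD \<omega> + K - fstar" for \<omega>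
  have U: "AE \<omega> in M. f (sszd_step F a h x (P \<omega>) (Z \<omega>)) - fstar \<le> U \<omega>"
    using PtP AE_space
  proof eventually_elim
    case (elim \<omega>)
    have z: "Z \<omega> \<in> space S"
      using elim Z by (auto dest: measurable_space)
    have Fq: "\<bar>F y (Z \<omega>) - F x (Z \<omega>) - D (Z \<omega>) \<bullet> (y - x)\<bar> \<le> lam / 2 * (norm (y - x))\<^sup>2" for y
      unfolding D_def using smooth[OF z] by (intro lipschitz_grad_quadratic_bound)
    have fq: "f y \<le> f x + v \<bullet> (y - x) + lam / 2 * (norm (y - x))\<^sup>2" for y
      using moments(5)[of y x] unfolding v_def by linarith
    show ?case
      using sszd_step_descent[of F "Z \<omega>" x "D (Z \<omega>)" lam f v "P \<omega>" a h, OF Fq fq] elim(1) a(1) h lam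
      by (simp add: U_def K_def d_def l_def)
  qed
  have U_int: "integrable M U"
    unfolding U_def using ints by simp
  \<comment> \<open>The descent term \<open>- a\<close> and the Young term \<open>a / 2\<close>
    multiply the same squared norm; half of the descent remains.\<close>
  have "expectation U = f x - fstar - a / 2 * (norm v)\<^sup>2 + lam * d / l * a\<^sup>2 * expectation ?DD + K"
    unfolding U_def using ints by (simp add: E_Dv E_vv prob_space)
  also have "\<dots> \<le> f x - fstar - a / 2 * (norm v)\<^sup>2
      + lam * d / l * a\<^sup>2 * (A * (f x - fstar) + B * (norm v)\<^sup>2 + G) + K"
    using E_DD lam d l by (intro add_mono mult_left_mono order_refl) auto
  also have "\<dots> \<le> R"
  proof -
    define c where "c = lam * d / l"
    have c: "0 < c"
      using lam d l by (simp add: c_def)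
    have g: "0 \<le> f x - fstar"
      using min by simp
    \<comment> \<open>The step-size condition keeps the total coefficient of
      \<open>(norm v)\<^sup>2\<close> nonpositive after the \<open>B\<close> term is absorbed, so
      the Polyak-Lojasiewicz bound acts in the right direction.\<close>
    have "2 * a * c * B \<le> 2 * abar * c * B"
      using a c AB by (intro mult_right_mono) auto
    also have "\<dots> \<le> 1"
      using abar by (simp add: c_def mult_ac)
    finally have "0 \<le> a / 2 * (1 - 2 * a * c * B)"
      using a by simp
    moreover have "\<gamma> * (f x - fstar) \<le> (norm v)\<^sup>2" and "0 < \<gamma>"
      using PL by (simp_all add: polyak_lojasiewicz_def fstar_def v_def)
    ultimately have 1: "a / 2 * (1 - 2 * a * c * B) * (\<gamma> * (f x - fstar))
        \<le> a / 2 * (1 - 2 * a * c * B) * (norm v)\<^sup>2"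
      by (intro mult_left_mono)
    \<comment> \<open>Only one of the two factors \<open>a\<close> is replaced by
      \<open>abar\<close>. The summand \<open>\<gamma> * B\<close> is what the absorbed
      \<open>B\<close> term becomes under the Polyak-Lojasiewicz bound.\<close>
    have 2: "a * a * (c * (A + \<gamma> * B) * (f x - fstar)) \<le> a * abar * (c * (A + \<gamma> * B) * (f x - fstar))"
      using a c AB \<open>0 < \<gamma>\<close> g by (intro mult_right_mono mult_left_mono) auto
    have "f x - fstar - a / 2 * (norm v)\<^sup>2 + c * a\<^sup>2 * (A * (f x - fstar) + B * (norm v)\<^sup>2 + G) + K
        = (f x - fstar) - a / 2 * (1 - 2 * a * c * B) * (norm v)\<^sup>2
          + c * a\<^sup>2 * A * (f x - fstar) + c * a\<^sup>2 * G + K"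
      by (simp add: field_simps power2_eq_square)
    also have "\<dots> \<le> (f x - fstar) - a / 2 * (1 - 2 * a * c * B) * (\<gamma> * (f x - fstar))
          + c * a\<^sup>2 * A * (f x - fstar) + c * a\<^sup>2 * G + K"
      using 1 by linarith
    also have "\<dots> = (1 - a * \<gamma> / 2) * (f x - fstar) + a * a * (c * (A + \<gamma> * B) * (f x - fstar))
          + c * a\<^sup>2 * G + K"
      by (simp add: field_simps power2_eq_square)
    also have "\<dots> \<le> (1 - a * \<gamma> / 2) * (f x - fstar) + a * abar * (c * (A + \<gamma> * B) * (f x - fstar))
          + c * a\<^sup>2 * G + K"
      using 2 by linarith
    also have "\<dots> = R"
      unfolding R_def K_def c_def by (simp add: algebra_simps)
    finally show ?thesis
      by (simp only: c_def)
  qed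
  finally have EU: "expectation U \<le> R" .
  have U_nonneg: "AE \<omega> in M. 0 \<le> U \<omega>"
    using U
  proof eventually_elim
    case (elim \<omega>)
    then show ?case
      using min[of "sszd_step F a h x (P \<omega>) (Z \<omega>)"] by simp
  qed
  show "0 \<le> R"
    using integral_nonneg_AE[OF U_nonneg] EU by simp
  have "(\<integral>\<^sup>+\<omega>. ennreal (f (sszd_step F a h x (P \<omega>) (Z \<omega>)) - fstar) \<partial>M) \<le> (\<integral>\<^sup>+\<omega>. ennreal (U \<omega>) \<partial>M)"
    using U by (intro nn_integral_mono_AE) (auto simp: ennreal_leI)
  also have "\<dots> = ennreal (expectation U)"
    using U_int U_nonneg by (rule nn_integral_eq_integral)
  also have "\<dots> \<le> ennreal R"
    using EU by (rule ennreal_leI)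
  finally show "(\<integral>\<^sup>+\<omega>. ennreal (f (sszd_step F a h x (P \<omega>) (Z \<omega>)) - fstar) \<partial>M) \<le> ennreal R" .
qed

end

subsection \<open>Independence of the iterates from the next sample\<close>

text \<open>The family of set systems from \<open>indep_sequences\<close>, named so that blocks of
  indices can be collected; \<open>Inl\<close> refers to the first sequence and \<open>Inr\<close>
  to the second.\<close>

definition generators ::
  "'w measure \<Rightarrow> 'b measure \<Rightarrow> (nat \<Rightarrow> 'w \<Rightarrow> 'b) \<Rightarrow> 'c measure \<Rightarrow> (nat \<Rightarrow> 'w \<Rightarrow> 'c) \<Rightarrow>
   nat + nat \<Rightarrow> 'w set set" where
  "generators M S X T Y = case_sum (\<lambda>k. {X k -` E \<inter> space M | E. E \<in> sets S})
                                   (\<lambda>k. {Y k -` E \<inter> space M | E. E \<in> sets T})"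

text \<open>Packaging the sigma-algebra as a measure lets \<open>measurable\<close> express that a
  variable depends only on the entries indexed by \<open>I\<close>.\<close>

definition joint_sigma ::
  "'w measure \<Rightarrow> 'b measure \<Rightarrow> (nat \<Rightarrow> 'w \<Rightarrow> 'b) \<Rightarrow> 'c measure \<Rightarrow> (nat \<Rightarrow> 'w \<Rightarrow> 'c) \<Rightarrow>
   (nat + nat) set \<Rightarrow> 'w measure" where
  "joint_sigma M S X T Y I = sigma (space M) (\<Union>i\<in>I. generators M S X T Y i)"

lemma generators_subset: "generators M S X T Y i \<subseteq> Pow (space M)"
  by (cases i) (auto simp: generators_def)

lemma space_joint_sigma [simp]: "space (joint_sigma M S X T Y I) = space M"
  using generators_subset by (subst joint_sigma_def, subst space_measure_of) blast+

lemma sets_joint_sigma: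
  "sets (joint_sigma M S X T Y I) = sigma_sets (space M) (\<Union>i\<in>I. generators M S X T Y i)"
  using generators_subset by (subst joint_sigma_def, subst sets_measure_of) blast+

lemma measurable_joint_sigma:
  assumes XY: "X k \<in> measurable M S" "Y k \<in> measurable M T"
  shows "Inl k \<in> I \<Longrightarrow> X k \<in> measurable (joint_sigma M S X T Y I) S"
    and "Inr k \<in> I \<Longrightarrow> Y k \<in> measurable (joint_sigma M S X T Y I) T"
proof -
  show "X k \<in> measurable (joint_sigma M S X T Y I) S" if "Inl k \<in> I"
  proof (rule measurableI)
    show "X k \<omega> \<in> space S" if "\<omega> \<in> space (joint_sigma M S X T Y I)" for \<omega>
      using that measurable_space[OF XY(1)] by simp
    show "X k -` E \<inter> space (joint_sigma M S X T Y I) \<in> sets (joint_sigma M S X T Y I)"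
      if "E \<in> sets S" for E
      unfolding sets_joint_sigma space_joint_sigma
      using that \<open>Inl k \<in> I\<close> by (intro sigma_sets.Basic UN_I[of "Inl k"]) (auto simp: generators_def)
  qed
  show "Y k \<in> measurable (joint_sigma M S X T Y I) T" if "Inr k \<in> I"
  proof (rule measurableI)
    show "Y k \<omega> \<in> space T" if "\<omega> \<in> space (joint_sigma M S X T Y I)" for \<omega>
      using that measurable_space[OF XY(2)] by simp
    show "Y k -` E \<inter> space (joint_sigma M S X T Y I) \<in> sets (joint_sigma M S X T Y I)"
      if "E \<in> sets T" for E
      unfolding sets_joint_sigma space_joint_sigma
      using that \<open>Inr k \<in> I\<close> by (intro sigma_sets.Basic UN_I[of "Inr k"]) (auto simp: generators_def)
  qed
qed

text \<open>Closure under intersections lets independence pass from generators to the sigma-algebras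
  they generate.\<close>

lemma Int_stable_preimages: "Int_stable {X -` E \<inter> space M | E. E \<in> sets S}"
  unfolding Int_stable_def
proof (intro ballI)
  fix a b assume "a \<in> {X -` E \<inter> space M | E. E \<in> sets S}" "b \<in> {X -` E \<inter> space M | E. E \<in> sets S}"
  then obtain E E' where "a = X -` E \<inter> space M" "b = X -` E' \<inter> space M" "E \<in> sets S" "E' \<in> sets S"
    by blast
  then show "a \<inter> b \<in> {X -` E \<inter> space M | E. E \<in> sets S}"
    by (intro CollectI exI[of _ "E \<inter> E'"]) auto
qed

text \<open>The measure \<open>N\<close> is arbitrary so that the sigma-algebra of the past can be
  inserted; only indices below \<open>k\<close> enter.\<close>

lemma borel_measurable_sszd:
  fixes F :: "real ^ 'd \<Rightarrow> 'z \<Rightarrow> real" and P :: "nat \<Rightarrow> 'a \<Rightarrow> real ^ 'l ^ 'd"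
  assumes F: "(\<lambda>(y, z). F y z) \<in> borel_measurable (borel \<Otimes>\<^sub>M S)"
    and PZ: "\<And>j. j < k \<Longrightarrow> P j \<in> borel_measurable N" "\<And>j. j < k \<Longrightarrow> Z j \<in> measurable N S"
  shows "sszd F \<alpha> h P Z x0 k \<in> borel_measurable N"
  using PZ
proof (induction k)
  case (Suc k)
  then have "sszd F \<alpha> h P Z x0 k \<in> borel_measurable N"
    by simp
  then show ?case
    unfolding sszd_Suc[abs_def] using Suc.prems by (intro borel_measurable_sszd_step[OF F]) auto
qed simp

context prob_space
begin

text \<open>Disjoint blocks of independent pi-systems generate independent sigma-algebras, and
  preimages under \<open>U\<close> and \<open>V\<close> lie in these.\<close>

lemma indep_sequences_indep_set:
  assumes indep: "indep_sequences M S X T Y" and disj: "I \<inter> J = {}"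
    and U: "U \<in> measurable (joint_sigma M S X T Y I) N"
    and V: "V \<in> measurable (joint_sigma M S X T Y J) N'"
  shows "indep_set {U -` E \<inter> space M | E. E \<in> sets N} {V -` E \<inter> space M | E. E \<in> sets N'}"
proof -
  let ?E = "generators M S X T Y"
  have "indep_sets ?E UNIV"
    using indep by (simp add: indep_sequences_def generators_def)
  then have "indep_sets ?E (\<Union>b. case_bool I J b)"
    by (rule indep_sets_mono_index[OF subset_UNIV])
  then have "indep_sets (\<lambda>b. sigma_sets (space M) (\<Union>i\<in>case_bool I J b. ?E i)) UNIV"
  proof (rule indep_sets_collect_sigma)
    show "Int_stable (?E i)" for i
      by (cases i) (simp_all add: generators_def Int_stable_preimages)
    show "disjoint_family (case_bool I J)"
      using disj by (auto simp: disjoint_family_on_def split: bool.split)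
  qed
  then show ?thesis
    unfolding indep_set_def
  proof (rule indep_sets_mono_sets)
    show "(case b of True \<Rightarrow> {U -` E \<inter> space M | E. E \<in> sets N}
        | False \<Rightarrow> {V -` E \<inter> space M | E. E \<in> sets N'})
        \<subseteq> sigma_sets (space M) (\<Union>i\<in>case_bool I J b. ?E i)" for b
      using measurable_sets[OF U] measurable_sets[OF V]
      by (cases b) (auto simp: sets_joint_sigma)
  qed
qed

lemma measurable_if_measurable_joint_sigma:
  assumes "indep_sequences M S X T Y" and U: "U \<in> measurable (joint_sigma M S X T Y I) N"
  shows "U \<in> measurable M N"
proof (rule measurableI)
  show "U \<omega> \<in> space N" if "\<omega> \<in> space M" for \<omega>
    using measurable_space[OF U] that by simp
  have "generators M S X T Y i \<subseteq> sets M" for i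
    using assms(1) by (cases i) (auto simp: indep_sequences_def generators_def intro: measurable_sets)
  then have "sets (joint_sigma M S X T Y I) \<subseteq> sets M"
    unfolding sets_joint_sigma by (intro sets.sigma_sets_subset) blast
  then show "U -` E \<inter> space M \<in> sets M" if "E \<in> sets N" for E
    using measurable_sets[OF U that] by auto
qed

text \<open>The joint law is a product, so Tonelli applies. This freezing of \<open>X\<close> takes
  the place of conditioning on the current iterate.\<close>

lemma nn_integral_indep_pair:
  assumes indep: "indep_set {X -` A \<inter> space M |A. A \<in> sets S} {Y -` B \<inter> space M |B. B \<in> sets T}"
    and X: "X \<in> measurable M S" and Y: "Y \<in> measurable M T"
    and g: "(\<lambda>(x, y). g x y) \<in> borel_measurable (S \<Otimes>\<^sub>M T)"
  shows "(\<integral>\<^sup>+\<omega>. g (X \<omega>) (Y \<omega>) \<partial>M) = (\<integral>\<^sup>+\<omega>. (\<integral>\<^sup>+\<omega>'. g (X \<omega>) (Y \<omega>') \<partial>M) \<partial>M)"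
proof -
  interpret T: prob_space "distr M T Y"
    using Y by (rule prob_space_distr)
  have gx: "g x \<in> borel_measurable T" if "x \<in> space S" for x
    using measurable_Pair2[OF g that] by simp
  have "(\<integral>\<^sup>+\<omega>. g (X \<omega>) (Y \<omega>) \<partial>M)
      = (\<integral>\<^sup>+p. case_prod g p \<partial>distr M (S \<Otimes>\<^sub>M T) (\<lambda>\<omega>. (X \<omega>, Y \<omega>)))"
    using X Y g by (subst nn_integral_distr) auto
  also have "\<dots> = (\<integral>\<^sup>+x. (\<integral>\<^sup>+y. g x y \<partial>distr M T Y) \<partial>distr M S X)"
    using g by (subst distr_pair_if_indep_set[OF indep X Y, symmetric],
        subst T.nn_integral_fst[symmetric]) auto
  also have "\<dots> = (\<integral>\<^sup>+\<omega>. (\<integral>\<^sup>+y. g (X \<omega>) y \<partial>distr M T Y) \<partial>M)"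
    using X g by (intro nn_integral_distr T.borel_measurable_nn_integral) auto
  also have "\<dots> = (\<integral>\<^sup>+\<omega>. (\<integral>\<^sup>+\<omega>'. g (X \<omega>) (Y \<omega>') \<partial>M) \<partial>M)"
    using gx Y measurable_space[OF X] by (intro nn_integral_cong nn_integral_distr) auto
  finally show ?thesis .
qed

end

section \<open>The recursion along the iterates\<close>

theorem theorem2:
  fixes M :: "'w measure" and S :: "'z measure"
    and F :: "real ^ 'd \<Rightarrow> 'z \<Rightarrow> real"
    and Z :: "'w \<Rightarrow> 'z" and Zs :: "nat \<Rightarrow> 'w \<Rightarrow> 'z"
    and P :: "nat \<Rightarrow> 'w \<Rightarrow> real ^ 'l ^ 'd"
    and \<alpha> h :: "nat \<Rightarrow> real" and \<alpha>bar lam A B G \<gamma> d l fstar :: real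
    and x0 :: "real ^ 'd" and f :: "real ^ 'd \<Rightarrow> real" and x :: "nat \<Rightarrow> 'w \<Rightarrow> real ^ 'd"
    and C :: "nat \<Rightarrow> real"
  defines "d \<equiv> real CARD('d)" and "l \<equiv> real CARD('l)"
    and "f \<equiv> objective M F Z" and "fstar \<equiv> (INF y. f y)"
    and "x \<equiv> sszd F \<alpha> h P Zs x0"
    and "C \<equiv> (\<lambda>k. lam * d / l * (\<alpha> k)\<^sup>2 * G
               + \<alpha> k * (h k)\<^sup>2 * (lam * d / (2 * sqrt l))\<^sup>2 * (1 / 2 + lam * d / l * \<alpha> k))"
  assumes "prob_space M"
    and "CARD('l) \<le> CARD('d)"
    and "Z \<in> measurable M S"
    and "\<And>y. F y \<in> borel_measurable S"
    and "smoothness_ABG M S F Z lam A B G"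
    and "polyak_lojasiewicz f \<gamma>"
    and "indep_sequences M borel P S Zs"
    and "\<And>k. distr M S (Zs k) = distr M S Z"
    and "\<And>k. (\<integral>\<omega>. P k \<omega> ** transpose (P k \<omega>) \<partial>M) = mat 1"
    and "\<And>k. AE \<omega> in M. transpose (P k \<omega>) ** P k \<omega> = (d / l) *\<^sub>R mat 1"
    and "\<And>k. \<alpha> k > 0" and "\<And>k. h k > 0"
    and "\<And>k. \<alpha> k \<le> \<alpha>bar" and "2 * \<alpha>bar * d * lam * B / l \<le> 1"
  shows "\<forall>k. integrable M (\<lambda>\<omega>. f (x k \<omega>)) \<and>
             (\<integral>\<omega>. f (x (Suc k) \<omega>) \<partial>M) - fstar
               \<le> (1 - \<alpha> k * (\<gamma> / 2 - d * lam * (A + \<gamma> * B) / l * \<alpha>bar))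
                   * ((\<integral>\<omega>. f (x k \<omega>) \<partial>M) - fstar) + C k"
proof -
  interpret prob_space M
    by fact
  note F = \<open>\<And>y. F y \<in> borel_measurable S\<close> and indep = \<open>indep_sequences M borel P S Zs\<close>
  note ABG = \<open>smoothness_ABG M S F Z lam A B G\<close>
  have P_meas: "P k \<in> borel_measurable M" and Z_meas: "Zs k \<in> measurable M S" for k
    using indep by (auto simp: indep_sequences_def)
  have diff_F: "(\<lambda>y. F y z) differentiable (at y)" if "z \<in> space S" for y z
    using ABG that by (auto simp: smoothness_ABG_def Let_def)
  have F_meas: "(\<lambda>(y, z). F y z) \<in> borel_measurable (borel \<Otimes>\<^sub>M S)"
    using F diff_F
    by (intro borel_measurable_caratheodory)
      (auto simp: continuous_on_eq_continuous_at intro: differentiable_imp_continuous_within)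
  have "continuous_on UNIV f"
    using ABG by (auto simp: smoothness_ABG_def Let_def f_def continuous_on_eq_continuous_at
        intro: differentiable_imp_continuous_within)
  then have f_meas: "f \<in> borel_measurable borel"
    by (rule borel_measurable_continuous_onI)
  have min: "fstar \<le> f y" for y
    unfolding fstar_def f_def using \<open>Z \<in> measurable M S\<close> F ABG by (rule objective_ge_INF)
  \<comment> \<open>The contraction factor carries no sign information here; nonnegativity of the
    full right-hand side is taken from the bound at a fixed point.\<close>
  define r where "r k = 1 - \<alpha> k * (\<gamma> / 2 - d * lam * (A + \<gamma> * B) / l * \<alpha>bar)" for k
  \<comment> \<open>The bound \<open>{..<k}\<close> is strict: the iterate with index
    \<open>k\<close> is built before \<open>P k\<close> and \<open>Zs k\<close> are drawn.\<close>
  have x_past: "x k \<in> borel_measurable (joint_sigma M borel P S Zs (Inl ` {..<k} \<union> Inr ` {..<k}))" for k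
    unfolding x_def using P_meas Z_meas
    by (intro borel_measurable_sszd[OF F_meas] measurable_joint_sigma) auto
  have x_meas: "x k \<in> borel_measurable M" for k
    using indep x_past by (rule measurable_if_measurable_joint_sigma)
  have step: "0 \<le> r k * (f y - fstar) + C k"
      "(\<integral>\<^sup>+\<omega>. ennreal (f (sszd_step F (\<alpha> k) (h k) y (P k \<omega>) (Zs k \<omega>)) - fstar) \<partial>M)
        \<le> ennreal (r k * (f y - fstar) + C k)" for k y
  proof -
    have ABG_k: "smoothness_ABG M S F (Zs k) lam A B G" and obj_k: "objective M F (Zs k) = f"
      using smoothness_ABG_cong_distr[OF \<open>Z \<in> measurable M S\<close> Z_meas
          \<open>\<And>k. distr M S (Zs k) = distr M S Z\<close> F ABG]
      by (simp_all add: f_def)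
    have "indep_set {P k -` E \<inter> space M |E. E \<in> sets borel} {Zs k -` E \<inter> space M |E. E \<in> sets S}"
      using P_meas Z_meas
      by (intro indep_sequences_indep_set[OF indep, of "{Inl k}" "{Inr k}"] measurable_joint_sigma) auto
    note descent = sszd_step_expected_descent[OF P_meas Z_meas F ABG_k _ this, where a = "\<alpha> k"
        and h = "h k" and abar = \<alpha>bar and \<gamma> = \<gamma> and x = y, unfolded obj_k, folded d_def l_def fstar_def]
    show "0 \<le> r k * (f y - fstar) + C k"
      unfolding r_def C_def by (rule descent) fact+
    show "(\<integral>\<^sup>+\<omega>. ennreal (f (sszd_step F (\<alpha> k) (h k) y (P k \<omega>) (Zs k \<omega>)) - fstar) \<partial>M)
        \<le> ennreal (r k * (f y - fstar) + C k)"
      unfolding r_def C_def by (rule descent) fact+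
  qed
  have nn_step: "(\<integral>\<^sup>+\<omega>. ennreal (f (x (Suc k) \<omega>) - fstar) \<partial>M)
      \<le> (\<integral>\<^sup>+\<omega>. ennreal (r k * (f (x k \<omega>) - fstar) + C k) \<partial>M)" for k
  proof -
    let ?g = "\<lambda>y (p, z). ennreal (f (sszd_step F (\<alpha> k) (h k) y p z) - fstar)"
    let ?PZ = "\<lambda>\<omega>. (P k \<omega>, Zs k \<omega>)"
    \<comment> \<open>The two indices \<open>k\<close> are disjoint from the past indices, which
      yields independence of the iterate from the new pair.\<close>
    have "?PZ \<in> measurable (joint_sigma M borel P S Zs {Inl k, Inr k}) (borel \<Otimes>\<^sub>M S)"
      using P_meas Z_meas by (intro measurable_Pair measurable_joint_sigma) auto
    then have indep_k: "indep_set {x k -` E \<inter> space M |E. E \<in> sets borel}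
        {?PZ -` E \<inter> space M |E. E \<in> sets (borel \<Otimes>\<^sub>M S)}"
      by (intro indep_sequences_indep_set[OF indep _ x_past]) auto
    have "(\<lambda>q. sszd_step F (\<alpha> k) (h k) (fst q) (fst (snd q)) (snd (snd q)))
        \<in> borel_measurable (borel \<Otimes>\<^sub>M (borel \<Otimes>\<^sub>M S))"
      by (intro borel_measurable_sszd_step[OF F_meas]) measurable
    from measurable_compose[OF this f_meas]
    have "(\<lambda>(y, q). ?g y q) \<in> borel_measurable (borel \<Otimes>\<^sub>M (borel \<Otimes>\<^sub>M S))"
      unfolding case_prod_beta'
      by (intro measurable_compose[OF _ measurable_ennreal] borel_measurable_diff) auto
    from nn_integral_indep_pair[OF indep_k x_meas measurable_Pair[OF P_meas Z_meas] this]
    have "(\<integral>\<^sup>+\<omega>. ennreal (f (x (Suc k) \<omega>) - fstar) \<partial>M) = (\<integral>\<^sup>+\<omega>. (\<integral>\<^sup>+\<omega>'.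
        ennreal (f (sszd_step F (\<alpha> k) (h k) (x k \<omega>) (P k \<omega>') (Zs k \<omega>')) - fstar) \<partial>M) \<partial>M)"
      by (simp add: x_def sszd_Suc del: sszd.simps)
    also have "\<dots> \<le> (\<integral>\<^sup>+\<omega>. ennreal (r k * (f (x k \<omega>) - fstar) + C k) \<partial>M)"
      by (intro nn_integral_mono step)
    finally show ?thesis .
  qed
  have gap_meas: "(\<lambda>\<omega>. f (x k \<omega>) - fstar) \<in> borel_measurable M" for k
    using measurable_compose[OF x_meas f_meas] by (intro borel_measurable_diff) auto
  \<comment> \<open>Pointwise nonnegativity from \<open>step\<close> allows the passage from the
    nonnegative integral to the expectation, whatever the sign of \<open>r k\<close>.\<close>
  have rhs: "(\<integral>\<^sup>+\<omega>. ennreal (r k * (f (x k \<omega>) - fstar) + C k) \<partial>M)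
      = ennreal (r k * (expectation (\<lambda>\<omega>. f (x k \<omega>)) - fstar) + C k)"
    and rhs_nonneg: "0 \<le> r k * (expectation (\<lambda>\<omega>. f (x k \<omega>)) - fstar) + C k"
    if "integrable M (\<lambda>\<omega>. f (x k \<omega>))" for k
  proof -
    have E: "expectation (\<lambda>\<omega>. r k * (f (x k \<omega>) - fstar) + C k)
        = r k * (expectation (\<lambda>\<omega>. f (x k \<omega>)) - fstar) + C k"
      using that by (simp add: prob_space)
    show "0 \<le> r k * (expectation (\<lambda>\<omega>. f (x k \<omega>)) - fstar) + C k"
      unfolding E[symmetric] by (intro integral_nonneg_AE AE_I2 step)
    show "(\<integral>\<^sup>+\<omega>. ennreal (r k * (f (x k \<omega>) - fstar) + C k) \<partial>M)
      = ennreal (r k * (expectation (\<lambda>\<omega>. f (x k \<omega>)) - fstar) + C k)"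
      unfolding E[symmetric] using that by (intro nn_integral_eq_integral AE_I2 step) auto
  qed
  \<comment> \<open>Integrability at \<open>k\<close> makes the right-hand side of
    \<open>nn_step\<close> finite, and a nonnegative gap with finite integral is integrable at
    \<open>Suc k\<close>. The start is deterministic.\<close>
  have f_int: "integrable M (\<lambda>\<omega>. f (x k \<omega>))" for k
  proof (induction k)
    case 0
    then show ?case
      by (simp add: x_def)
  next
    case (Suc k)
    have "integrable M (\<lambda>\<omega>. f (x (Suc k) \<omega>) - fstar)"
    proof (rule integrableI_nonneg[OF gap_meas])
      show "(\<integral>\<^sup>+\<omega>. ennreal (f (x (Suc k) \<omega>) - fstar) \<partial>M) < \<infinity>"
        using nn_step[of k] unfolding rhs[OF Suc] by (rule le_less_trans) simp
      show "AE \<omega> in M. 0 \<le> f (x (Suc k) \<omega>) - fstar"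
        using min by simp
    qed
    then have "integrable M (\<lambda>\<omega>. (f (x (Suc k) \<omega>) - fstar) + fstar)"
      by (intro Bochner_Integration.integrable_add) auto
    then show ?case
      by simp
  qed
  have "expectation (\<lambda>\<omega>. f (x (Suc k) \<omega>)) - fstar
      \<le> r k * (expectation (\<lambda>\<omega>. f (x k \<omega>)) - fstar) + C k" for k
  proof -
    have "ennreal (expectation (\<lambda>\<omega>. f (x (Suc k) \<omega>) - fstar))
        = (\<integral>\<^sup>+\<omega>. ennreal (f (x (Suc k) \<omega>) - fstar) \<partial>M)"
      using f_int min by (intro nn_integral_eq_integral[symmetric]) auto
    also have "\<dots> \<le> ennreal (r k * (expectation (\<lambda>\<omega>. f (x k \<omega>)) - fstar) + C k)"
      using nn_step[of k] by (simp only: rhs[OF f_int])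
    finally have "expectation (\<lambda>\<omega>. f (x (Suc k) \<omega>) - fstar)
        \<le> r k * (expectation (\<lambda>\<omega>. f (x k \<omega>)) - fstar) + C k"
      using rhs_nonneg[OF f_int] by (simp add: ennreal_le_iff)
    then show ?thesis
      using f_int by (simp add: prob_space)
  qed
  then show ?thesis
    using f_int by (auto simp: r_def)
qed

end
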